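(* Let $\alpha,\beta\in\mathbb{C}$ with $|\alpha|=|\beta|=1$, where $\beta=e^{2\pi\mathbf{i}\theta}$ with $\theta$ irrational. For $\rho>0$ let $\mathbb{S}^1_\rho=\{y\in\mathbb{C}: |y|=\rho\}$ and define $A^{\alpha,\rho}\colon\mathbb{S}^1_\rho\to \mathrm{M}(2;\mathbb{C})$ by $A^{\alpha,\rho}(y)=\begin{pmatrix}\alpha & y\\ 1 & 1\end{pmatrix}$. Then the Lyapunov exponent of the cocycle $(A^{\alpha,\rho},\beta)$ is \begin{itemize} \item positive as soon as $\rho>1$; \item zero as soon as $\rho\le 1$. \end{itemize} More precisely, the birational map $f_{\alpha,\beta}(x,y)=\left(\frac{\alpha x+y}{x+1},\beta y\right)$ of $\mathbb{P}^1_\mathbb{C}\times\mathbb{P}^1_\mathbb{C}$ is semi-conjugate, via $(x,y)\mapsto(x,y^2)$, to $g(x,y)=\left(\frac{\alpha x+y^2}{x+1},\beta^{1/2}y\right)$ (i.e. $f_{\alpha,\beta}\circ(x,y^2)=(x,y^2)\circ g$), and the Lyapunov exponent of the cocycle $(B^{\alpha,\rho},\beta^{1/2})$, where $B^{\alpha,\rho}(y)=\begin{pmatrix}\alpha & y^2\\ 1& 1\end{pmatrix}$ for $y\in\mathbb{S}^1_\rho$, is equal to $\max(0,\ln\rho)$.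
   Context: Here $\beta^{1/2}$ denotes a fixed square root of $\beta$. For a continuous (analytic) map $C\colon\mathbb{S}^1_\rho\to\mathrm{M}(2;\mathbb{C})$ and $\gamma\in\mathbb{C}$ with $|\gamma|=1$, the cocycle $(C,\gamma)$ is the skew product $(v,y)\mapsto (C(y)v,\gamma y)$ on $\mathbb{C}^2\times\mathbb{S}^1_\rho$; its iterates are $C_n(y)=C(\gamma^{n-1}y)\cdots C(\gamma y)C(y)$, and its Lyapunov exponent is $L(C,\gamma)=\lim_{n\to+\infty}\frac1n\int_{\mathbb{S}^1_\rho}\ln\|C_n(y)\|\,\mathrm{d}y$, where $\mathrm{d}y$ is the normalized Lebesgue (Haar) measure on $\mathbb{S}^1_\rho$. The map $f_{\alpha,\beta}$ is the affine expression of the birational map $(x:y:z)\dashrightarrow((\alpha x+y)z:\beta y(x+z):z(x+z))$ of $\mathbb{P}^2_\mathbb{C}$; its iterates $f^n_{\alpha,\beta}(x,y)$ act on the first coordinate by the Möbius transformation associated with the matrix product of the $A^{\alpha,\rho}(\beta^k y)$. *)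

theory Defs
  imports "HOL-Analysis.Analysis"
begin

definition mat2 :: "complex \<Rightarrow> complex \<Rightarrow> complex \<Rightarrow> complex \<Rightarrow> complex^2^2" where
  "mat2 a b c d = (\<chi> i j. if i = 1 then (if j = 1 then a else b) else (if j = 1 then c else d))"

fun cocycle_iter :: "(complex \<Rightarrow> complex^2^2) \<Rightarrow> complex \<Rightarrow> nat \<Rightarrow> complex \<Rightarrow> complex^2^2" where
  "cocycle_iter C \<gamma> 0 y = mat 1"
| "cocycle_iter C \<gamma> (Suc n) y = C (\<gamma> ^ n * y) ** cocycle_iter C \<gamma> n y"

definition circle_avg_log :: "(complex \<Rightarrow> complex^2^2) \<Rightarrow> complex \<Rightarrow> real \<Rightarrow> nat \<Rightarrow> real" where
  "circle_avg_log C \<gamma> \<rho> n =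
     (LINT t:{0..2*pi}|lborel. ln (norm (cocycle_iter C \<gamma> n (complex_of_real \<rho> * cis t)))) / (2*pi)"

definition lyap_seq :: "(complex \<Rightarrow> complex^2^2) \<Rightarrow> complex \<Rightarrow> real \<Rightarrow> nat \<Rightarrow> real" where
  "lyap_seq C \<gamma> \<rho> n = circle_avg_log C \<gamma> \<rho> n / real n"

definition lyapunov_exponent :: "(complex \<Rightarrow> complex^2^2) \<Rightarrow> complex \<Rightarrow> real \<Rightarrow> real" where
  "lyapunov_exponent C \<gamma> \<rho> = lim (lyap_seq C \<gamma> \<rho>)"

definition A_cocycle :: "complex \<Rightarrow> complex \<Rightarrow> complex^2^2" where
  "A_cocycle \<alpha> y = mat2 \<alpha> y 1 1"

definition B_cocycle :: "complex \<Rightarrow> complex \<Rightarrow> complex^2^2" where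
  "B_cocycle \<alpha> y = mat2 \<alpha> (y^2) 1 1"

definition f_map :: "complex \<Rightarrow> complex \<Rightarrow> complex \<times> complex \<Rightarrow> complex \<times> complex" where
  "f_map \<alpha> \<beta> = (\<lambda>(x, y). ((\<alpha> * x + y) / (x + 1), \<beta> * y))"

definition g_map :: "complex \<Rightarrow> complex \<Rightarrow> complex \<times> complex \<Rightarrow> complex \<times> complex" where
  "g_map \<alpha> s = (\<lambda>(x, y). ((\<alpha> * x + y^2) / (x + 1), s * y))"

definition sq_map :: "complex \<times> complex \<Rightarrow> complex \<times> complex" where
  "sq_map = (\<lambda>(x, y). (x, y^2))"

end

theory Submission
  imports Defs "HOL-Complex_Analysis.Cauchy_Integral_Formula" "HOL-Computational_Algebra.Formal_Power_Series"
begin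

text \<open>
  Lower bound: the determinant of the \<open>n\<close>-th iterate is \<open>\<Prod>k<n. \<alpha> - \<beta>^k y\<close>, it is at most the
  squared norm, and Jensen's formula gives the mean of its logarithm on every circle of radius other
  than 1; radius 1 follows by continuity, since irrationality of the rotation prevents the iterates
  from vanishing.

  Upper bound: the lower left entries of the iterates satisfy a linear recurrence of order two, and the
  coefficient of \<open>y^k\<close> in them is, up to a power of \<open>\<beta>\<close>, a complete homogeneous symmetric polynomial
  in \<open>1, \<beta>, \<dots>, \<beta>^k, \<alpha>, \<alpha>\<beta>, \<dots>, \<alpha>\<beta>^k\<close>. The power sums of these points are bounded by
  \<open>2 (k + 1)\<close> and, independently of \<open>k\<close>, by \<open>4 / |1 - \<beta>^i|\<close>, so Newton's identities make the
  coefficients subexponential in \<open>n\<close>. As the degree in \<open>y\<close> is at most \<open>n / 2\<close>, the iterates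
  are bounded on the circle of radius \<open>\<rho>\<close> by \<open>max(1, \<rho>)^(n/2)\<close> up to a subexponential factor.
\<close>

unbundle no vec_syntax and fps_syntax

section \<open>Geometric series, complete homogeneous polynomials and Newton's identities\<close>

definition geometric_fps :: "'a :: comm_ring_1 \<Rightarrow> 'a fps" where
  "geometric_fps c = Abs_fps (\<lambda>n. c ^ n)"

lemma geometric_fps_nth [simp]: "geometric_fps c $ n = c ^ n"
  by (simp add: geometric_fps_def)

lemma geometric_fps_mult: "(1 - fps_const c * fps_X) * geometric_fps c = 1"
proof (rule fps_ext)
  fix n
  show "((1 - fps_const c * fps_X) * geometric_fps c) $ n = (1 :: 'a fps) $ n"
    by (cases n) (simp_all add: algebra_simps)
qed

lemma geometric_fps_compose:
  fixes c :: "'a :: field"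
  shows "geometric_fps c oo (fps_const b * fps_X) = geometric_fps (c * b)"
  by (rule fps_ext) (simp add: fps_compose_linear power_mult_distrib)

text \<open>The logarithmic derivative of \<open>1 / (1 - c z)\<close> is
  \<open>c / (1 - c z)\<close>, written as a product so that no series has to be divided.\<close>

lemma deriv_geometric_fps:
  "fps_deriv (geometric_fps c) = geometric_fps c * Abs_fps (\<lambda>n. c ^ Suc n)"
proof (rule fps_ext)
  fix n
  have "(geometric_fps c * Abs_fps (\<lambda>n. c ^ Suc n)) $ n = (\<Sum>i=0..n. c ^ Suc n)"
    unfolding fps_mult_nth
    by (intro sum.cong refl) (simp flip: power_add power_Suc)
  then show "fps_deriv (geometric_fps c) $ n = (geometric_fps c * Abs_fps (\<lambda>n. c ^ Suc n)) $ n"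
    by simp
qed

text \<open>The generating function of the complete homogeneous symmetric polynomials in the
  \<open>x i\<close>. Indexing by \<open>i\<close> counts repeated points with multiplicity.\<close>

definition complete_hom_fps :: "('i \<Rightarrow> 'a :: comm_ring_1) \<Rightarrow> 'i set \<Rightarrow> 'a fps" where
  "complete_hom_fps x S = (\<Prod>i\<in>S. geometric_fps (x i))"

text \<open>Logarithmic derivatives add over the product, so the second factor is the generating
  function of the power sums.\<close>

lemma deriv_complete_hom_fps:
  assumes "finite S"
  shows "fps_deriv (complete_hom_fps x S) =
           complete_hom_fps x S * Abs_fps (\<lambda>n. \<Sum>i\<in>S. x i ^ Suc n)"
  using assms
proof (induction S rule: finite_induct)
  case empty
  show ?case by (simp add: complete_hom_fps_def fps_eq_iff fps_mult_nth)
next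
  case (insert a S)
  have "Abs_fps (\<lambda>n. \<Sum>i\<in>insert a S. x i ^ Suc n) =
          Abs_fps (\<lambda>n. x a ^ Suc n) + Abs_fps (\<lambda>n. \<Sum>i\<in>S. x i ^ Suc n)"
    using insert by (simp add: fps_eq_iff)
  moreover have "complete_hom_fps x (insert a S) = geometric_fps (x a) * complete_hom_fps x S"
    using insert by (simp add: complete_hom_fps_def)
  ultimately show ?case
    by (simp add: insert.IH deriv_geometric_fps algebra_simps)
qed

text \<open>Newton's identity between complete homogeneous polynomials and power sums, read off as
  the coefficient of \<open>z^m\<close> in the differential equation above.\<close>

lemma complete_hom_Newton:
  assumes "finite S"
  shows "of_nat (Suc m) * complete_hom_fps x S $ Suc m =
           (\<Sum>i=0..m. complete_hom_fps x S $ i * (\<Sum>j\<in>S. x j ^ Suc (m - i)))"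
  using arg_cong[OF deriv_complete_hom_fps[OF assms, of x], of "\<lambda>f. f $ m"]
  by (simp add: fps_mult_nth)

lemma complete_hom_0: "finite S \<Longrightarrow> complete_hom_fps x S $ 0 = 1"
  by (induction S rule: finite_induct) (simp_all add: complete_hom_fps_def fps_mult_nth)

text \<open>
  The majorant is the sequence of coefficients of \<open>exp (\<Sum>i. q i * z ^ i / i)\<close>; with the sums of
  \<open>q i * r ^ i\<close> bounded by \<open>Q\<close>, the partial sums of \<open>exp Q\<close> suffice.
\<close>
lemma Newton_recurrence_bound:
  fixes h :: "nat \<Rightarrow> 'a :: real_normed_vector" and q :: "nat \<Rightarrow> real"
  assumes h0: "norm (h 0) \<le> 1"
    and rec: "\<And>m. real (Suc m) * norm (h (Suc m)) \<le> (\<Sum>i=0..m. norm (h i) * q (Suc (m - i)))"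
    and q: "\<And>i. 0 \<le> q i" and "r > 0"
    and Q: "\<And>m. (\<Sum>i\<le>m. q (Suc i) * r ^ Suc i) \<le> Q"
  shows "norm (h m) * r ^ m \<le> exp Q"
proof -
  define E where "E = (\<lambda>m. \<Sum>i\<le>m. Q ^ i / fact i)"
  have Q0: "0 \<le> Q"
  proof -
    have "0 \<le> q (Suc 0) * r" using q[of "Suc 0"] \<open>r > 0\<close> by simp
    also have "\<dots> \<le> Q" using Q[of 0] by simp
    finally show ?thesis .
  qed
  have E_mono: "E i \<le> E j" if "i \<le> j" for i j
    unfolding E_def using that Q0 by (intro sum_mono2) auto
  have "norm (h m) * r ^ m \<le> E m"
  proof (induction m rule: less_induct)
    case (less m)
    show ?case
    proof (cases m)
      case 0
      then show ?thesis using h0 by (simp add: E_def)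
    next
      case (Suc n)
      have "real (Suc n) * (norm (h (Suc n)) * r ^ Suc n)
              \<le> (\<Sum>i=0..n. norm (h i) * q (Suc (n - i))) * r ^ Suc n"
        using mult_right_mono[OF rec[of n], of "r ^ Suc n"] \<open>r > 0\<close> by (simp add: mult.assoc)
      also have "\<dots> = (\<Sum>i=0..n. (norm (h i) * r ^ i) * (q (Suc (n - i)) * r ^ Suc (n - i)))"
        unfolding sum_distrib_right
      proof (intro sum.cong refl)
        fix i assume "i \<in> {0..n}"
        then have "r ^ Suc n = r ^ i * r ^ Suc (n - i)" by (simp flip: power_add power_Suc)
        then show "norm (h i) * q (Suc (n - i)) * r ^ Suc n =
            norm (h i) * r ^ i * (q (Suc (n - i)) * r ^ Suc (n - i))" by simp
      qed
      also have "\<dots> \<le> (\<Sum>i=0..n. E n * (q (Suc (n - i)) * r ^ Suc (n - i)))"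
      proof (intro sum_mono mult_right_mono)
        fix i assume "i \<in> {0..n}"
        then have "norm (h i) * r ^ i \<le> E i" "E i \<le> E n"
          using Suc by (auto intro: less.IH E_mono)
        then show "norm (h i) * r ^ i \<le> E n" by simp
      qed (use q \<open>r > 0\<close> in simp)
      also have "\<dots> = E n * (\<Sum>i\<le>n. q (Suc i) * r ^ Suc i)"
        unfolding sum_distrib_left
        by (rule sum.reindex_bij_witness[of _ "\<lambda>i. n - i" "\<lambda>i. n - i"]) auto
      also have "\<dots> \<le> E n * Q"
        using Q0 by (intro mult_left_mono Q) (simp add: E_def sum_nonneg)
      also have "\<dots> = (\<Sum>i\<le>n. Q ^ Suc i / fact i)"
        unfolding E_def sum_distrib_right by (simp add: mult.commute)
      \<comment> \<open>Termwise comparison of \<open>Q * E n\<close> with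
        \<open>(n + 1) * E (n + 1)\<close>: since \<open>i + 1 \<le> n + 1\<close>, the factor
        \<open>n + 1\<close> from the recurrence pays for one more term of the exponential
        series.\<close>
      also have "\<dots> \<le> (\<Sum>i\<le>n. real (Suc n) * (Q ^ Suc i / fact (Suc i)))"
      proof (rule sum_mono)
        fix i assume "i \<in> {..n}"
        have "Q ^ Suc i / fact i = real (Suc i) * (Q ^ Suc i / fact (Suc i))"
          by (simp add: field_simps del: power_Suc of_nat_Suc)
        also have "\<dots> \<le> real (Suc n) * (Q ^ Suc i / fact (Suc i))"
          using \<open>i \<in> {..n}\<close> Q0 by (intro mult_right_mono) auto
        finally show "Q ^ Suc i / fact i \<le> real (Suc n) * (Q ^ Suc i / fact (Suc i))" .
      qed
      also have "\<dots> \<le> real (Suc n) * E (Suc n)"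
        unfolding E_def sum.atMost_Suc_shift sum_distrib_left[symmetric]
        by (intro mult_left_mono) auto
      finally show ?thesis using Suc by (simp del: of_nat_Suc power_Suc)
    qed
  qed
  also have "E m \<le> exp Q"
    using sum_le_suminf[of "\<lambda>i. Q ^ i / fact i" "{..m}"] summable_exp_generic[of Q] Q0
    by (simp add: E_def exp_def divide_inverse mult.commute scaleR_conv_of_real)
  finally show ?thesis .
qed

section \<open>The coefficients of the iterates\<close>

text \<open>The points are \<open>\<beta>^j\<close> and \<open>\<alpha> \<beta>^j\<close> for
  \<open>j \<le> k\<close>. The boolean tells the two families apart, so coincidences between them
  keep their multiplicity.\<close>

definition twist_fps :: "complex \<Rightarrow> complex \<Rightarrow> nat \<Rightarrow> complex fps" where
  "twist_fps \<alpha> \<beta> k =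
     complete_hom_fps (\<lambda>(j, e). (if e then \<alpha> else 1) * \<beta> ^ j) ({..k} \<times> (UNIV :: bool set))"

lemma twist_fps_eq_prod:
  "twist_fps \<alpha> \<beta> k = (\<Prod>j\<le>k. geometric_fps (\<beta> ^ j) * geometric_fps (\<alpha> * \<beta> ^ j))"
  unfolding twist_fps_def complete_hom_fps_def
  by (simp add: prod.cartesian_product' UNIV_bool mult.commute)

text \<open>Replacing \<open>z\<close> by \<open>\<beta> z\<close> multiplies every point by
  \<open>\<beta>\<close>; the points lost at \<open>j = 0\<close> are \<open>1\<close> and
  \<open>\<alpha>\<close>.\<close>

lemma twist_fps_Suc:
  "twist_fps \<alpha> \<beta> (Suc k) = geometric_fps 1 * geometric_fps \<alpha> *
     (twist_fps \<alpha> \<beta> k oo (fps_const \<beta> * fps_X))"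
proof -
  have "twist_fps \<alpha> \<beta> k oo (fps_const \<beta> * fps_X) =
          (\<Prod>j\<le>k. geometric_fps (\<beta> ^ Suc j) * geometric_fps (\<alpha> * \<beta> ^ Suc j))"
    unfolding twist_fps_eq_prod
    by (subst fps_compose_prod_distrib)
       (simp_all add: fps_compose_mult_distrib geometric_fps_compose power_Suc2 mult.assoc del: power_Suc)
  then show ?thesis
    unfolding twist_fps_eq_prod prod.atMost_Suc_shift by simp
qed

text \<open>
  The coefficient of \<open>y ^ k\<close> in the generating function \<open>V\<close> of the solution of the recurrence,
  obtained by iterating \<open>(1 - z) (1 - \<alpha> z) V(z) = 1 + \<beta> y z\<^sup>2 V(\<beta> z)\<close>.
\<close>
definition coeff_fps :: "complex \<Rightarrow> complex \<Rightarrow> nat \<Rightarrow> complex fps" where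
  "coeff_fps \<alpha> \<beta> k = fps_const (\<beta> ^ (k\<^sup>2)) * fps_X ^ (2 * k) * twist_fps \<alpha> \<beta> k"

lemma coeff_fps_nth:
  "coeff_fps \<alpha> \<beta> k $ n = (if 2 * k \<le> n then \<beta> ^ (k\<^sup>2) * twist_fps \<alpha> \<beta> k $ (n - 2 * k) else 0)"
  by (simp add: coeff_fps_def mult.assoc fps_X_power_mult_nth)

lemma quadratic_mult_nth:
  fixes f :: "complex fps"
  shows "((1 - fps_const 1 * fps_X) * (1 - fps_const \<alpha> * fps_X) * f) $ Suc (Suc n) =
           f $ Suc (Suc n) - (1 + \<alpha>) * f $ Suc n + \<alpha> * f $ n"
proof -
  have "(1 - fps_const 1 * fps_X) * (1 - fps_const \<alpha> * fps_X) * f =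
          f - fps_const (1 + \<alpha>) * (fps_X * f) + fps_const \<alpha> * (fps_X * (fps_X * f))"
    by (simp add: algebra_simps flip: fps_const_add)
  then show ?thesis by simp
qed

lemma quadratic_mult_geometric:
  "(1 - fps_const 1 * fps_X) * (1 - fps_const \<alpha> * fps_X) * (geometric_fps 1 * geometric_fps \<alpha> * f) = f"
proof -
  have "(1 - fps_const 1 * fps_X) * (1 - fps_const \<alpha> * fps_X) * (geometric_fps 1 * geometric_fps \<alpha> * f)
      = ((1 - fps_const 1 * fps_X) * geometric_fps 1) * ((1 - fps_const \<alpha> * fps_X) * geometric_fps \<alpha>) * f"
    by (simp only: mult_ac)
  then show ?thesis by (simp only: geometric_fps_mult mult_1_left)
qed

lemma coeff_fps_0_rec:
  "coeff_fps \<alpha> \<beta> 0 $ Suc (Suc n) = (1 + \<alpha>) * coeff_fps \<alpha> \<beta> 0 $ Suc n - \<alpha> * coeff_fps \<alpha> \<beta> 0 $ n"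
proof -
  have "coeff_fps \<alpha> \<beta> 0 = geometric_fps 1 * geometric_fps \<alpha> * 1"
    by (simp add: coeff_fps_def twist_fps_eq_prod)
  then have "(1 - fps_const 1 * fps_X) * (1 - fps_const \<alpha> * fps_X) * coeff_fps \<alpha> \<beta> 0 = 1"
    by (simp only: quadratic_mult_geometric)
  from arg_cong[OF this, of "\<lambda>f. f $ Suc (Suc n)"] show ?thesis
    by (simp only: quadratic_mult_nth) (simp add: algebra_simps)
qed

text \<open>Coefficient form of \<open>(1 - z) (1 - \<alpha> z) V_(k+1)(z) = \<beta> z^2 V_k(\<beta>
  z)\<close>, where \<open>V_k\<close> is \<open>coeff_fps \<alpha> \<beta> k\<close>.\<close>

lemma coeff_fps_Suc_rec:
  "coeff_fps \<alpha> \<beta> (Suc k) $ Suc (Suc n) =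
     (1 + \<alpha>) * coeff_fps \<alpha> \<beta> (Suc k) $ Suc n - \<alpha> * coeff_fps \<alpha> \<beta> (Suc k) $ n
       + \<beta> ^ Suc n * coeff_fps \<alpha> \<beta> k $ n"
proof -
  let ?T = "\<lambda>f. f oo (fps_const \<beta> * fps_X)"
  have "coeff_fps \<alpha> \<beta> (Suc k) = geometric_fps 1 * geometric_fps \<alpha> *
          (fps_const (\<beta> ^ ((Suc k)\<^sup>2)) * fps_X ^ (2 * Suc k) * ?T (twist_fps \<alpha> \<beta> k))"
    by (simp only: coeff_fps_def twist_fps_Suc mult_ac)
  then have "(1 - fps_const 1 * fps_X) * (1 - fps_const \<alpha> * fps_X) * coeff_fps \<alpha> \<beta> (Suc k) =
      fps_const (\<beta> ^ ((Suc k)\<^sup>2)) * fps_X ^ (2 * Suc k) * ?T (twist_fps \<alpha> \<beta> k)"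
    by (simp only: quadratic_mult_geometric)
  from arg_cong[OF this, of "\<lambda>f. f $ Suc (Suc n)", unfolded quadratic_mult_nth]
  have "coeff_fps \<alpha> \<beta> (Suc k) $ Suc (Suc n) - (1 + \<alpha>) * coeff_fps \<alpha> \<beta> (Suc k) $ Suc n
          + \<alpha> * coeff_fps \<alpha> \<beta> (Suc k) $ n =
        (fps_const (\<beta> ^ ((Suc k)\<^sup>2)) * fps_X ^ (2 * Suc k) * ?T (twist_fps \<alpha> \<beta> k)) $ Suc (Suc n)" .
  also have "\<dots> = (if 2 * k \<le> n then \<beta> ^ ((Suc k)\<^sup>2) * (\<beta> ^ (n - 2 * k) * twist_fps \<alpha> \<beta> k $ (n - 2 * k)) else 0)"
    by (simp add: mult.assoc fps_X_power_mult_nth del: power_Suc)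
  also have "\<dots> = \<beta> ^ Suc n * coeff_fps \<alpha> \<beta> k $ n"
  proof (cases "2 * k \<le> n")
    case True
    have "(Suc k)\<^sup>2 + (n - 2 * k) = Suc n + k\<^sup>2"
      using True by (simp add: power2_eq_square)
    then have "\<beta> ^ ((Suc k)\<^sup>2) * \<beta> ^ (n - 2 * k) = \<beta> ^ Suc n * \<beta> ^ (k\<^sup>2)"
      by (metis power_add)
    with True show ?thesis by (simp add: coeff_fps_nth flip: mult.assoc)
  qed (simp add: coeff_fps_nth)
  finally show ?thesis by (simp add: algebra_simps)
qed

lemma coeff_fps_eq_0: "n < 2 * k \<Longrightarrow> coeff_fps \<alpha> \<beta> k $ n = 0"
  by (simp add: coeff_fps_nth)

text \<open>Both sides satisfy the same recurrence and initial values. Terms with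
  \<open>2 * k > n\<close> vanish, so any \<open>N \<ge> n\<close> may bound the sum, and one range
  serves all indices in the induction.\<close>

lemma recurrence_solution:
  fixes a :: "nat \<Rightarrow> complex"
  assumes a0: "a 0 = 1" and a1: "a 1 = 1 + \<alpha>"
    and rec: "\<And>n. a (Suc (Suc n)) = (1 + \<alpha>) * a (Suc n) + (\<beta> ^ Suc n * y - \<alpha>) * a n"
    and "n \<le> N"
  shows "a n = (\<Sum>k\<le>N. y ^ k * coeff_fps \<alpha> \<beta> k $ n)"
  using \<open>n \<le> N\<close>
proof (induction n rule: induct_nat_012)
  case 0
  have "(\<Sum>k\<le>N. y ^ k * coeff_fps \<alpha> \<beta> k $ 0) = (\<Sum>k\<in>{0}. y ^ k * coeff_fps \<alpha> \<beta> k $ 0)"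
    by (intro sum.mono_neutral_right) (auto simp: coeff_fps_eq_0)
  also have "\<dots> = 1"
    by (simp add: coeff_fps_nth twist_fps_eq_prod)
  finally show ?case using a0 by simp
next
  case 1
  have "(\<Sum>k\<le>N. y ^ k * coeff_fps \<alpha> \<beta> k $ Suc 0) = (\<Sum>k\<in>{0}. y ^ k * coeff_fps \<alpha> \<beta> k $ Suc 0)"
    by (intro sum.mono_neutral_right) (auto simp: coeff_fps_eq_0)
  also have "\<dots> = 1 + \<alpha>"
    by (simp add: coeff_fps_nth twist_fps_eq_prod fps_mult_nth)
  finally show ?case using a1 by simp
next
  case (ge2 n)
  define c where "c = coeff_fps \<alpha> \<beta>"
  obtain M where N: "N = Suc M" and M: "n < M" using ge2.prems by (cases N) auto
  have IH: "a n = (\<Sum>k\<le>N. y ^ k * c k $ n)" "a (Suc n) = (\<Sum>k\<le>N. y ^ k * c k $ Suc n)"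
    using ge2 by (auto simp: c_def)
  \<comment> \<open>The top term vanishes, so shifting \<open>k\<close> to \<open>k + 1\<close>
    stays within the range up to \<open>N\<close>.\<close>
  have "(\<Sum>k\<le>N. y ^ k * c k $ n) = (\<Sum>k\<le>M. y ^ k * c k $ n)"
    using M by (simp add: N c_def coeff_fps_eq_0)
  then have shift: "(\<Sum>k\<le>M. y ^ Suc k * (\<beta> ^ Suc n * c k $ n)) = \<beta> ^ Suc n * y * a n"
    by (simp add: IH sum_distrib_left mult_ac)
  have "(\<Sum>k\<le>N. y ^ k * c k $ Suc (Suc n)) =
      (\<Sum>k\<le>N. y ^ k * ((1 + \<alpha>) * c k $ Suc n - \<alpha> * c k $ n))
        + (\<Sum>k\<le>M. y ^ Suc k * (\<beta> ^ Suc n * c k $ n))"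
    unfolding N sum.atMost_Suc_shift c_def coeff_fps_0_rec coeff_fps_Suc_rec
    by (simp add: distrib_left sum.distrib)
  also have "(\<Sum>k\<le>N. y ^ k * ((1 + \<alpha>) * c k $ Suc n - \<alpha> * c k $ n)) = (1 + \<alpha>) * a (Suc n) - \<alpha> * a n"
    unfolding IH sum_distrib_left by (simp add: sum_subtractf[symmetric] algebra_simps)
  also note shift
  finally show ?case unfolding rec c_def by (simp add: algebra_simps)
qed

section \<open>The upper bound\<close>

text \<open>The power sum factors as \<open>1 + \<alpha>^i\<close> times a geometric sum with ratio
  \<open>\<beta>^i\<close>, which is bounded by its number of terms or by its closed form.\<close>

lemma twist_power_sum_bound:
  fixes \<alpha> \<beta> :: complex
  assumes "norm \<alpha> = 1" "norm \<beta> = 1"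
  defines "p \<equiv> \<lambda>k i. \<Sum>(j, e)\<in>{..k} \<times> (UNIV :: bool set). ((if e then \<alpha> else 1) * \<beta> ^ j) ^ i"
  shows "norm (p k i) \<le> 2 * real (Suc k)"
    and "\<beta> ^ i \<noteq> 1 \<Longrightarrow> norm (p k i) \<le> 4 / norm (1 - \<beta> ^ i)"
proof -
  define g where "g = (\<Sum>j\<le>k. (\<beta> ^ i) ^ j)"
  have "p k i = (1 + \<alpha> ^ i) * g"
    unfolding p_def g_def
    by (simp add: sum.cartesian_product' UNIV_bool power_mult_distrib
        sum.distrib distrib_right sum_distrib_left flip: power_mult) (simp add: mult.commute)
  moreover have "norm (1 + \<alpha> ^ i) \<le> 2"
    using norm_triangle_ineq[of 1 "\<alpha> ^ i"] assms by (simp add: norm_power)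
  ultimately have p: "norm (p k i) \<le> 2 * norm g"
    by (simp add: norm_mult mult_right_mono)
  have "norm g \<le> (\<Sum>j\<le>k. 1)"
    unfolding g_def by (rule sum_norm_le) (simp add: norm_power assms)
  with p show "norm (p k i) \<le> 2 * real (Suc k)" by simp
  assume "\<beta> ^ i \<noteq> 1"
  have "norm (1 - \<beta> ^ i) * norm g = norm (1 - (\<beta> ^ i) ^ Suc k)"
    unfolding g_def by (simp only: norm_mult[symmetric] sum_gp_basic)
  also have "\<dots> \<le> 2"
    using norm_triangle_ineq4[of 1 "(\<beta> ^ i) ^ Suc k"] assms by (simp add: norm_power norm_mult)
  finally have "norm g \<le> 2 / norm (1 - \<beta> ^ i)"
    using \<open>\<beta> ^ i \<noteq> 1\<close> by (simp add: field_simps)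
  with p show "norm (p k i) \<le> 4 / norm (1 - \<beta> ^ i)" by simp
qed

text \<open>In Newton's identities the finitely many power sums of small index contribute a constant
  independent of \<open>k\<close>; the linear bound on the others is damped by the tail of
  \<open>\<Sum>i. r^i\<close>.\<close>

lemma twist_fps_nth_bound:
  assumes "norm \<alpha> = 1" "norm \<beta> = 1" and aperiodic: "\<And>i. 0 < i \<Longrightarrow> \<beta> ^ i \<noteq> 1" and "\<delta> > 0"
  obtains C where "\<And>k m. norm (twist_fps \<alpha> \<beta> k $ m) \<le> exp (C + \<delta> * real k + \<delta> * real m)"
proof -
  define r where "r = exp (- \<delta>)"
  have r: "0 < r" "r < 1" using \<open>\<delta> > 0\<close> by (auto simp: r_def)
  have "summable (\<lambda>i. r ^ Suc i)"
    using r by (subst summable_Suc_iff) (simp add: summable_geometric)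
  \<comment> \<open>The tail carries the weight \<open>2 (k + 1)\<close>, so
    \<open>\<delta> / 2\<close> makes its contribution at most \<open>\<delta> k + \<delta>\<close>;
    the summand \<open>\<delta>\<close> of \<open>C\<close> absorbs the last term.\<close>
  then obtain M where M: "\<And>n. norm (\<Sum>i=M..<n. r ^ Suc i) < \<delta> / 2"
    using \<open>\<delta> > 0\<close> unfolding summable_Cauchy by (meson half_gt_zero order_refl)
  define C where "C = (\<Sum>i<M. 4 / norm (1 - \<beta> ^ Suc i)) + \<delta>"
  define q where "q = (\<lambda>k i. norm (\<Sum>(j, e)\<in>{..k} \<times> (UNIV :: bool set). ((if e then \<alpha> else 1) * \<beta> ^ j) ^ i))"
  have "norm (twist_fps \<alpha> \<beta> k $ m) \<le> exp (C + \<delta> * real k + \<delta> * real m)" for k m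
  proof -
    have "norm (twist_fps \<alpha> \<beta> k $ m) * r ^ m \<le> exp (C + \<delta> * real k)"
    proof (rule Newton_recurrence_bound[where q = "q k"])
      show "norm (twist_fps \<alpha> \<beta> k $ 0) \<le> 1"
        by (simp add: twist_fps_def complete_hom_0)
      show "0 \<le> q k i" for i by (simp add: q_def)
      show "real (Suc m) * norm (twist_fps \<alpha> \<beta> k $ Suc m)
              \<le> (\<Sum>i=0..m. norm (twist_fps \<alpha> \<beta> k $ i) * q k (Suc (m - i)))" for m
      proof -
        have "real (Suc m) * norm (twist_fps \<alpha> \<beta> k $ Suc m) =
                norm (of_nat (Suc m) * twist_fps \<alpha> \<beta> k $ Suc m)"
          by (simp only: norm_mult norm_of_nat)
        also have "\<dots> \<le> (\<Sum>i=0..m. norm (twist_fps \<alpha> \<beta> k $ i) * q k (Suc (m - i)))"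
          unfolding twist_fps_def q_def complete_hom_Newton[OF finite_cartesian_product[OF finite_atMost finite]]
          by (rule sum_norm_le) (simp add: norm_mult split_def)
        finally show ?thesis .
      qed
      show "(\<Sum>i\<le>m. q k (Suc i) * r ^ Suc i) \<le> C + \<delta> * real k" for m
      proof -
        have "(\<Sum>i\<le>m. q k (Suc i) * r ^ Suc i)
                \<le> (\<Sum>i\<in>{..<M} \<union> {M..<Suc m}. q k (Suc i) * r ^ Suc i)"
          using r by (intro sum_mono2) (auto simp: q_def)
        also have "\<dots> = (\<Sum>i<M. q k (Suc i) * r ^ Suc i) + (\<Sum>i=M..<Suc m. q k (Suc i) * r ^ Suc i)"
          by (intro sum.union_disjoint) auto
        \<comment> \<open>Below \<open>M\<close> the closed-form bound is used together with
          \<open>r^(i+1) \<le> 1\<close>; from \<open>M\<close> on, the bound linear in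
          \<open>k\<close>.\<close>
        also have "\<dots> \<le> (\<Sum>i<M. 4 / norm (1 - \<beta> ^ Suc i) * 1) + (\<Sum>i=M..<Suc m. 2 * real (Suc k) * r ^ Suc i)"
        proof (intro add_mono sum_mono mult_mono)
          show "q k (Suc i) \<le> 4 / norm (1 - \<beta> ^ Suc i)" for i
            unfolding q_def using assms by (intro twist_power_sum_bound(2)) (auto simp del: power_Suc)
          show "q k (Suc i) \<le> 2 * real (Suc k)" for i
            unfolding q_def using assms by (intro twist_power_sum_bound) auto
          show "r ^ Suc i \<le> 1" for i
            using r by (intro power_le_one) auto
        qed (use r in \<open>auto simp: q_def\<close>)
        also have "\<dots> = (C - \<delta>) + 2 * real (Suc k) * (\<Sum>i=M..<Suc m. r ^ Suc i)"
          by (simp only: C_def sum_distrib_left mult_1_right add_diff_cancel_right')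
        also have "\<dots> \<le> (C - \<delta>) + 2 * real (Suc k) * (\<delta> / 2)"
          using M[of "Suc m"] by (intro add_left_mono mult_left_mono) auto
        also have "\<dots> = C + \<delta> * real k" by (simp add: algebra_simps)
        finally show ?thesis .
      qed
    qed (use r in auto)
    moreover have "r ^ m * exp (\<delta> * real m) = 1"
      by (simp add: r_def exp_of_nat_mult[symmetric] exp_add[symmetric] algebra_simps)
    ultimately show ?thesis
      using mult_right_mono[of "norm (twist_fps \<alpha> \<beta> k $ m) * r ^ m" "exp (C + \<delta> * real k)" "exp (\<delta> * real m)"]
      by (simp add: exp_add mult.assoc)
  qed
  then show thesis by (rule that)
qed

text \<open>Only powers \<open>y^k\<close> with \<open>2 * k \<le> n\<close> occur, hence
  \<open>|y|^k \<le> S^(2k) \<le> S^n\<close>. The constant depends on neither \<open>S\<close> nor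
  \<open>y\<close>.\<close>

lemma recurrence_bound:
  fixes \<alpha> \<beta> :: complex
  assumes "norm \<alpha> = 1" "norm \<beta> = 1" and aperiodic: "\<And>i. 0 < i \<Longrightarrow> \<beta> ^ i \<noteq> 1" and "\<delta> > 0"
  obtains K where "K > 0"
    and "\<And>S y a n. \<lbrakk>S \<ge> 1; norm y \<le> S\<^sup>2; a 0 = 1; a 1 = 1 + \<alpha>;
           \<And>n. a (Suc (Suc n)) = (1 + \<alpha>) * a (Suc n) + (\<beta> ^ Suc n * y - \<alpha>) * a n\<rbrakk>
           \<Longrightarrow> norm (a n) \<le> K * (S * exp \<delta>) ^ n"
proof -
  \<comment> \<open>One half of \<open>\<delta>\<close> is spent on the size of the coefficients,
    the other on their number \<open>n + 1\<close>.\<close>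
  define d where "d = \<delta> / 2"
  have d: "d > 0" "\<delta> = d + d" using \<open>\<delta> > 0\<close> by (auto simp: d_def)
  obtain C where C: "\<And>k m. norm (twist_fps \<alpha> \<beta> k $ m) \<le> exp (C + d * real k + d * real m)"
    using twist_fps_nth_bound[OF assms(1-3) d(1)] by blast
  have coeff: "norm (coeff_fps \<alpha> \<beta> k $ n) \<le> exp (C + d * real n)" if "2 * k \<le> n" for k n
  proof -
    have "norm (coeff_fps \<alpha> \<beta> k $ n) \<le> exp (C + d * real k + d * real (n - 2 * k))"
      using C[of k "n - 2 * k"] that by (simp add: coeff_fps_nth norm_mult norm_power assms)
    also have "\<dots> \<le> exp (C + d * real n)"
      using that d by (simp add: add.assoc flip: distrib_left)
    finally show ?thesis .
  qed
  define K where "K = (1 + 1 / d) * exp C"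
  have "norm (a n) \<le> K * (S * exp \<delta>) ^ n"
    if S: "S \<ge> 1" "norm y \<le> S\<^sup>2" and a: "a 0 = 1" "a 1 = 1 + \<alpha>"
      "\<And>n. a (Suc (Suc n)) = (1 + \<alpha>) * a (Suc n) + (\<beta> ^ Suc n * y - \<alpha>) * a n" for S y a n
  proof -
    have "norm (a n) = norm (\<Sum>k\<le>n. y ^ k * coeff_fps \<alpha> \<beta> k $ n)"
      using recurrence_solution[of a, OF a order_refl] by simp
    also have "\<dots> \<le> (\<Sum>k\<le>n. S ^ n * exp (C + d * real n))"
    proof (rule sum_norm_le)
      fix k
      show "norm (y ^ k * coeff_fps \<alpha> \<beta> k $ n) \<le> S ^ n * exp (C + d * real n)"
      proof (cases "2 * k \<le> n")
        case True
        have "norm y ^ k \<le> (S\<^sup>2) ^ k" using S by (intro power_mono) auto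
        also have "\<dots> = S ^ (2 * k)" by (simp add: power_mult)
        also have "\<dots> \<le> S ^ n" using S True by (intro power_increasing) auto
        finally show ?thesis
          unfolding norm_mult norm_power using coeff[OF True] S by (intro mult_mono) auto
      next
        case False
        then show ?thesis using S by (simp add: coeff_fps_eq_0)
      qed
    qed
    also have "\<dots> = (1 + real n) * (S ^ n * exp (C + d * real n))" by simp
    also have "\<dots> \<le> ((1 + 1 / d) * exp (d * real n)) * (S ^ n * exp (C + d * real n))"
    proof (intro mult_right_mono)
      have "d * real n \<le> exp (d * real n)"
        using exp_ge_add_one_self[of "d * real n"] by linarith
      then have "real n \<le> exp (d * real n) / d" using d by (simp add: field_simps)
      moreover have "1 \<le> exp (d * real n)" using d by simp
      ultimately have "1 + real n \<le> exp (d * real n) + exp (d * real n) / d" by (rule add_mono[rotated])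
      then show "1 + real n \<le> (1 + 1 / d) * exp (d * real n)" by (simp add: distrib_right)
    qed (use S in auto)
    also have "\<dots> = K * (S * exp \<delta>) ^ n"
    proof -
      have "exp \<delta> ^ n = exp (d * real n) * exp (d * real n)"
        by (simp add: d exp_of_nat_mult[symmetric] exp_add[symmetric] algebra_simps)
      then show ?thesis by (simp add: K_def power_mult_distrib exp_add mult_ac)
    qed
    finally show ?thesis .
  qed
  moreover have "K > 0" using d by (simp add: K_def add_pos_pos)
  ultimately show thesis using that by blast
qed

unbundle no fps_syntax and vec_syntax

section \<open>Two-by-two matrices and the growth of the iterates\<close>

lemma norm_mat2_le:
  fixes M :: "complex^2^2"
  shows "norm M \<le> norm (M $ 1 $ 1) + norm (M $ 1 $ 2) + norm (M $ 2 $ 1) + norm (M $ 2 $ 2)"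
proof -
  have "norm M \<le> norm (M $ 1) + norm (M $ 2)"
    using L2_set_le_sum[of UNIV "\<lambda>i. norm (M $ i)"] by (simp add: norm_vec_def[of M] sum_2)
  moreover have "norm (M $ i) \<le> norm (M $ i $ 1) + norm (M $ i $ 2)" for i
    using L2_set_le_sum[of UNIV "\<lambda>j. norm (M $ i $ j)"] by (simp add: norm_vec_def[of "M $ i"] sum_2)
  from this[of 1] this[of 2] calculation show ?thesis by linarith
qed

text \<open>The norm is the Frobenius norm, so the inequality of arithmetic and geometric means
  applied to both products of the determinant suffices.\<close>

lemma norm_det_mat2_le:
  fixes M :: "complex^2^2"
  shows "norm (det M) \<le> (norm M)\<^sup>2"
proof -
  have amgm: "norm (a * b) \<le> ((norm a)\<^sup>2 + (norm b)\<^sup>2) / 2" for a b :: complex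
    using sum_squares_bound[of "norm a" "norm b"] by (simp add: norm_mult)
  have "(norm M)\<^sup>2 = (norm (M$1$1))\<^sup>2 + (norm (M$1$2))\<^sup>2 + (norm (M$2$1))\<^sup>2 + (norm (M$2$2))\<^sup>2"
    by (simp add: norm_vec_def L2_set_def sum_2)
  moreover have "norm (det M) \<le> norm (M$1$1 * M$2$2) + norm (M$1$2 * M$2$1)"
    unfolding det_2 by (rule norm_triangle_ineq4)
  ultimately show ?thesis
    using amgm[of "M$1$1" "M$2$2"] amgm[of "M$1$2" "M$2$1"] 
      zero_le_power2[of "norm M"] by argo
qed

lemma A_cocycle_nth [simp]:
  "A_cocycle \<alpha> y $ 1 $ 1 = \<alpha>" "A_cocycle \<alpha> y $ 1 $ 2 = y"
  "A_cocycle \<alpha> y $ 2 $ 1 = 1" "A_cocycle \<alpha> y $ 2 $ 2 = 1"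
  by (simp_all add: A_cocycle_def mat2_def)

lemma mult_mat2_nth:
  fixes M N :: "complex^2^2"
  shows "(M ** N) $ i $ j = M $ i $ 1 * N $ 1 $ j + M $ i $ 2 * N $ 2 $ j"
  by (simp add: matrix_matrix_mult_def sum_2)

text \<open>Splits off the factor applied first, where the definition splits off the one applied
  last. This links the two columns of the iterates.\<close>

lemma cocycle_iter_Suc_right:
  "cocycle_iter C \<gamma> (Suc n) y = cocycle_iter C \<gamma> n (\<gamma> * y) ** C y"
proof (induction n)
  case (Suc n)
  have "cocycle_iter C \<gamma> (Suc (Suc n)) y = C (\<gamma> ^ Suc n * y) ** cocycle_iter C \<gamma> (Suc n) y"
    by (simp only: cocycle_iter.simps)
  also have "\<dots> = cocycle_iter C \<gamma> (Suc n) (\<gamma> * y) ** C y"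
    unfolding Suc by (simp add: matrix_mul_assoc mult_ac)
  finally show ?case .
qed simp

text \<open>The lower left entry solves the scalar recurrence; the upper left one is a difference of
  two consecutive lower left ones, and the second column comes from the first columns of two
  consecutive iterates.\<close>

lemma cocycle_iter_A_bound:
  assumes "norm \<alpha> = 1" "norm \<beta> = 1" and aperiodic: "\<And>i. 0 < i \<Longrightarrow> \<beta> ^ i \<noteq> 1"
    and "\<delta> > 0" "S \<ge> 1"
  obtains K where "K > 0"
    and "\<And>y n. norm y \<le> S\<^sup>2 \<Longrightarrow> norm (cocycle_iter (A_cocycle \<alpha>) \<beta> n y) \<le> K * (S * exp \<delta>) ^ n"
proof -
  define P where "P = cocycle_iter (A_cocycle \<alpha>) \<beta>"
  define T where "T = S * exp \<delta>"
  have T: "T \<ge> 1" using mult_mono[of 1 S 1 "exp \<delta>"] assms by (simp add: T_def)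
  obtain K where "K > 0" and K: "\<And>y a n. \<lbrakk>norm y \<le> S\<^sup>2; a 0 = 1; a 1 = 1 + \<alpha>;
      \<And>n. a (Suc (Suc n)) = (1 + \<alpha>) * a (Suc n) + (\<beta> ^ Suc n * y - \<alpha>) * a n\<rbrakk> \<Longrightarrow> norm (a n) \<le> K * T ^ n"
    using recurrence_bound[OF assms(1-4)] \<open>S \<ge> 1\<close> unfolding T_def by metis
  have P11: "P (Suc n) y $ 1 $ 1 = \<alpha> * P n y $ 1 $ 1 + \<beta> ^ n * y * P n y $ 2 $ 1"
    and P21: "P (Suc n) y $ 2 $ 1 = P n y $ 1 $ 1 + P n y $ 2 $ 1" for n y
    by (simp_all add: P_def mult_mat2_nth)
  have P0: "P 0 y $ 1 $ 1 = 1" "P 0 y $ 2 $ 1 = 0" for y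
    by (simp_all add: P_def mat_def)
  \<comment> \<open>Eliminating the upper left entry gives the recurrence. The index starts at
    \<open>Suc n\<close>, since the entry is 0 at the identity and takes the values \<open>1\<close>
    and \<open>1 + \<alpha>\<close> next.\<close>
  have Suc21: "norm (P (Suc n) y $ 2 $ 1) \<le> K * T ^ n" if "norm y \<le> S\<^sup>2" for n y
  proof (rule K[OF that])
    show "P (Suc (Suc (Suc n))) y $ 2 $ 1 =
        (1 + \<alpha>) * P (Suc (Suc n)) y $ 2 $ 1 + (\<beta> ^ Suc n * y - \<alpha>) * P (Suc n) y $ 2 $ 1" for n
    proof -
      have "P (Suc n) y $ 1 $ 1 = P (Suc (Suc n)) y $ 2 $ 1 - P (Suc n) y $ 2 $ 1"
        by (simp add: P21)
      then show ?thesis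
        by (simp only: P21[of "Suc (Suc n)"] P11[of "Suc n"]) (simp add: algebra_simps)
    qed
  qed (simp_all add: P21 P11 P0)
  have mono: "K * T ^ n \<le> K * T ^ Suc n" for n
    using T \<open>K > 0\<close> by (intro mult_left_mono power_increasing) auto
  have col21: "norm (P n y $ 2 $ 1) \<le> K * T ^ n" if "norm y \<le> S\<^sup>2" for n y
  proof (cases n)
    case 0
    then show ?thesis using \<open>K > 0\<close> by (simp add: P0)
  next
    case (Suc m)
    then show ?thesis using Suc21[OF that, of m] mono[of m] by simp
  qed
  have col11: "norm (P n y $ 1 $ 1) \<le> 2 * K * T ^ n" if "norm y \<le> S\<^sup>2" for n y
  proof -
    have "P n y $ 1 $ 1 = P (Suc n) y $ 2 $ 1 - P n y $ 2 $ 1" by (simp add: P21)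
    then show ?thesis
      using norm_triangle_ineq4[of "P (Suc n) y $ 2 $ 1" "P n y $ 2 $ 1"] Suc21[OF that, of n] col21[OF that, of n]
      by simp
  qed
  have col1: "norm (P n y $ i $ 1) \<le> 2 * K * T ^ n" if "norm y \<le> S\<^sup>2" for n y i
  proof -
    have "K * T ^ n \<le> 2 * K * T ^ n" using \<open>K > 0\<close> T by simp
    then show ?thesis
      using col11[OF that, of n] col21[OF that, of n] exhaust_2[of i] by force
  qed
  have col2: "norm (P n y $ i $ 2) \<le> 2 * K * (T + 1) * T ^ n" if "norm y \<le> S\<^sup>2" for n y i
  proof -
    \<comment> \<open>Stepping back by one rotation keeps the modulus, and the first column of
      \<open>A_cocycle \<alpha> z\<close> is \<open>(\<alpha>, 1)\<close>, whose second entry brings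
      in the second column of \<open>P n y\<close>.\<close>
    define z where "z = y / \<beta>"
    have z: "norm z \<le> S\<^sup>2" "\<beta> * z = y"
      using that assms(2) by (auto simp: z_def norm_divide)
    have "P (Suc n) z = P n y ** A_cocycle \<alpha> z"
      unfolding P_def cocycle_iter_Suc_right z ..
    then have "P n y $ i $ 2 = P (Suc n) z $ i $ 1 - P n y $ i $ 1 * \<alpha>"
      by (simp add: mult_mat2_nth)
    also have "norm \<dots> \<le> 2 * K * T ^ Suc n + 2 * K * T ^ n"
      using norm_triangle_ineq4[of "P (Suc n) z $ i $ 1" "P n y $ i $ 1 * \<alpha>"]
        col1[OF z(1), of "Suc n" i] col1[OF that, of n i] assms(1) by (simp add: norm_mult)
    finally show ?thesis by (simp add: algebra_simps)
  qed
  have "norm (P n y) \<le> (4 * K + 4 * K * (T + 1)) * T ^ n" if "norm y \<le> S\<^sup>2" for n y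
    using norm_mat2_le[of "P n y"] col1[OF that, of n 1] col1[OF that, of n 2]
      col2[OF that, of n 1] col2[OF that, of n 2] by (simp add: algebra_simps)
  moreover have "4 * K + 4 * K * (T + 1) > 0"
    using \<open>K > 0\<close> T by (intro add_pos_pos mult_pos_pos) auto
  ultimately show thesis
    using that unfolding P_def T_def by blast
qed

section \<open>The lower bound\<close>

text \<open>Mean value property at 0 for the real part of \<open>Ln (1 - c z^m)\<close>, which is
  holomorphic on the closed disc because its argument stays in the right half plane. As
  \<open>m > 0\<close>, the value at 0 is \<open>Ln 1 = 0\<close>.\<close>

lemma Jensen_circle_inside:
  fixes c :: complex
  assumes "norm c < 1" "0 < m"
  shows "((\<lambda>t. ln (norm (1 - c * cis t ^ m))) has_integral 0) {0..2 * pi}"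
proof -
  define f where "f = (\<lambda>z. Ln (1 - c * z ^ m))"
  have pos: "Re (1 - c * z ^ m) > 0" if "norm z \<le> 1" for z
  proof -
    have "norm (c * z ^ m) \<le> norm c * 1"
      unfolding norm_mult norm_power using that by (intro mult_left_mono power_le_one) auto
    then show ?thesis using assms complex_Re_le_cmod[of "c * z ^ m"] by simp
  qed
  have "f holomorphic_on cball 0 1"
    unfolding f_def
  proof (intro holomorphic_intros)
    fix z :: complex assume "z \<in> cball 0 1"
    then show "1 - c * z ^ m \<notin> \<real>\<^sub>\<le>\<^sub>0"
      using pos[of z] by (auto simp: complex_nonpos_Reals_iff)
  qed
  then have "((\<lambda>u. f u / (u - 0)) has_contour_integral (2 * of_real pi * \<i> * f 0)) (circlepath 0 1)"
    by (rule Cauchy_integral_circlepath_simple) simp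
  then have "((\<lambda>t. f (cis t) * \<i>) has_integral 0) {0..2 * pi}"
    using \<open>0 < m\<close> by (simp add: circlepath_def has_contour_integral_part_circlepath_iff f_def power_0_left)
  from has_integral_linear[OF this bounded_linear_Im]
  have "((\<lambda>t. Re (f (cis t))) has_integral 0) {0..2 * pi}" by (simp add: o_def)
  moreover have "Re (f (cis t)) = ln (norm (1 - c * cis t ^ m))" for t
  proof -
    have "1 - c * cis t ^ m \<noteq> 0" using pos[of "cis t"] by (metis norm_cis order_refl less_irrefl zero_complex.sel(1))
    then show ?thesis unfolding f_def by (rule Re_Ln)
  qed
  ultimately show ?thesis by simp
qed

text \<open>Both cases reduce to the zero-free one by taking out the dominant term: \<open>a\<close>
  for \<open>R < 1\<close>, the term with \<open>R\<close> for \<open>R > 1\<close>.\<close>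

lemma Jensen_circle:
  fixes a b :: complex
  assumes "norm a = 1" "norm b = 1" "0 < m" "0 < R" "R \<noteq> 1"
  shows "((\<lambda>t. ln (norm (a - b * (of_real R * cis t ^ m)))) has_integral (2 * pi * max 0 (ln R))) {0..2 * pi}"
proof (cases "R < 1")
  case True
  have "norm (1 - (of_real R * b / a) * cis t ^ m) = norm (a - b * (of_real R * cis t ^ m))" for t
  proof -
    have "a - b * (of_real R * cis t ^ m) = a * (1 - (of_real R * b / a) * cis t ^ m)"
      using assms by (auto simp: field_simps)
    then show ?thesis using assms by (simp add: norm_mult)
  qed
  moreover have "norm (of_real R * b / a) < 1"
    using assms True by (simp add: norm_mult norm_divide)
  moreover have "max 0 (ln R) = 0" using True assms by simp
  ultimately show ?thesis
    using Jensen_circle_inside[of "of_real R * b / a" m] assms by simp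
next
  case False
  \<comment> \<open>The remaining factor is \<open>1 - d w\<close> with \<open>w\<close> the inverse
    of \<open>cis t ^ m\<close>. On the unit circle conjugation turns \<open>w\<close> into
    \<open>cis t ^ m\<close> without changing the modulus.\<close>
  define d where "d = a / (of_real R * b)"
  have "norm (cnj d) < 1"
    using assms False by (simp add: d_def norm_mult norm_divide)
  have eq: "ln (norm (a - b * (of_real R * cis t ^ m))) = ln R + ln (norm (1 - cnj d * cis t ^ m))" for t
  proof -
    have "cnj (cis t ^ m) * cis t ^ m = 1"
      by (simp add: cis_cnj cis_mult flip: power_mult_distrib)
    then have "a - b * (of_real R * cis t ^ m) = - (of_real R * b * cis t ^ m) * cnj (1 - cnj d * cis t ^ m)"
      using assms by (simp add: d_def field_simps) (auto simp: mult_ac)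
    then have "norm (a - b * (of_real R * cis t ^ m)) = R * norm (1 - cnj d * cis t ^ m)"
      using assms by (simp only: norm_mult complex_mod_cnj norm_minus_cancel norm_power norm_cis) simp
    moreover have "norm (cnj d * cis t ^ m) < 1"
      using \<open>norm (cnj d) < 1\<close> by (simp add: norm_mult norm_power)
    then have "1 - cnj d * cis t ^ m \<noteq> 0" by auto
    ultimately show ?thesis using assms by (simp add: ln_mult)
  qed
  have "((\<lambda>t. ln R + ln (norm (1 - cnj d * cis t ^ m))) has_integral ((2 * pi - 0) *\<^sub>R ln R + 0)) {0..2 * pi}"
    using has_integral_const_real[of "ln R" 0 "2 * pi"]
    by (intro has_integral_add Jensen_circle_inside \<open>norm (cnj d) < 1\<close> assms) simp
  moreover have "max 0 (ln R) = ln R" using False by simp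
  ultimately show ?thesis by (simp add: eq)
qed

lemma det_cocycle_iter_A:
  "det (cocycle_iter (A_cocycle \<alpha>) \<beta> n y) = (\<Prod>k<n. \<alpha> - \<beta> ^ k * y)"
proof (induction n)
  case (Suc n)
  have "det (A_cocycle \<alpha> (\<beta> ^ n * y)) = \<alpha> - \<beta> ^ n * y" by (simp add: det_2)
  with Suc show ?case by (simp add: det_mul mult.commute)
qed simp

text \<open>By aperiodicity at most one factor is singular. Cancelling invertible factors from a
  vanishing product would make a single \<open>A_cocycle\<close> matrix or the identity
  zero.\<close>

lemma cocycle_iter_A_nonzero:
  assumes "\<alpha> \<noteq> 0" "\<beta> \<noteq> 0" and aperiodic: "\<And>i. 0 < i \<Longrightarrow> \<beta> ^ i \<noteq> 1"
  shows "cocycle_iter (A_cocycle \<alpha>) \<beta> n y \<noteq> 0"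
proof (induction n)
  case 0
  have "(mat 1 :: complex^2^2) $ 1 $ 1 = 1" by (simp add: mat_def)
  then show ?case by auto
next
  case (Suc n)
  show ?case
  proof
    assume 0: "cocycle_iter (A_cocycle \<alpha>) \<beta> (Suc n) y = 0"
    show False
    proof (cases "\<beta> ^ n * y = \<alpha>")
      case True
      have "\<beta> ^ k * y \<noteq> \<alpha>" if "k < n" for k
      proof
        assume "\<beta> ^ k * y = \<alpha>"
        moreover have "\<beta> ^ n = \<beta> ^ (n - k) * \<beta> ^ k"
          using that by (simp flip: power_add)
        ultimately have "\<beta> ^ (n - k) * \<alpha> = \<alpha>" using True by (simp add: mult.assoc)
        then show False using aperiodic[of "n - k"] that \<open>\<alpha> \<noteq> 0\<close> by simp
      qed
      then have "det (cocycle_iter (A_cocycle \<alpha>) \<beta> n y) \<noteq> 0"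
        by (auto simp: det_cocycle_iter_A)
      then obtain N where N: "cocycle_iter (A_cocycle \<alpha>) \<beta> n y ** N = mat 1"
        using invertible_det_nz invertible_def by blast
      have "A_cocycle \<alpha> (\<beta> ^ n * y) = cocycle_iter (A_cocycle \<alpha>) \<beta> (Suc n) y ** N"
        by (simp add: N flip: matrix_mul_assoc)
      also have "\<dots> = 0" unfolding 0 by simp
      finally have "A_cocycle \<alpha> (\<beta> ^ n * y) $ 2 $ 1 = 0" by simp
      then show False by simp
    next
      case False
      then have "det (A_cocycle \<alpha> (\<beta> ^ n * y)) \<noteq> 0" by (simp add: det_2)
      then obtain N where N: "N ** A_cocycle \<alpha> (\<beta> ^ n * y) = mat 1"
        using invertible_det_nz invertible_def by blast
      have "cocycle_iter (A_cocycle \<alpha>) \<beta> n y = N ** cocycle_iter (A_cocycle \<alpha>) \<beta> (Suc n) y"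
        by (simp add: N matrix_mul_assoc)
      also have "\<dots> = 0" unfolding 0 by simp
      finally show False using Suc by simp
    qed
  qed
qed

lemma continuous_on_cocycle_iter_A: "continuous_on UNIV (cocycle_iter (A_cocycle \<alpha>) \<beta> n)"
proof (induction n)
  case (Suc n)
  have "continuous_on UNIV (\<lambda>y. A_cocycle \<alpha> (\<beta> ^ n * y) $ i $ j)" for i j
  proof -
    have "i = 1 \<or> i = 2" "j = 1 \<or> j = 2" using exhaust_2 by auto
    then have eq: "(\<lambda>y. A_cocycle \<alpha> (\<beta> ^ n * y) $ i $ j) =
        (if j = 2 \<and> i = 1 then (\<lambda>y. \<beta> ^ n * y) else (\<lambda>y. if i = 1 then \<alpha> else 1))"
      by (auto simp: fun_eq_iff)
    show ?thesis unfolding eq by (auto intro!: continuous_intros)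
  qed
  moreover have "continuous_on UNIV (\<lambda>y. cocycle_iter (A_cocycle \<alpha>) \<beta> n y $ i $ j)" for i j
    by (intro continuous_on_component Suc)
  ultimately show ?case
    unfolding cocycle_iter.simps matrix_matrix_mult_def
    by (intro continuous_on_vec_lambda continuous_on_sum continuous_on_mult)
qed simp

lemma aperiodic_rotation:
  assumes "\<theta> \<notin> \<rat>" "0 < i"
  shows "cis (2 * pi * \<theta>) ^ i \<noteq> 1"
proof
  assume "cis (2 * pi * \<theta>) ^ i = 1"
  then have "cis (real i * (2 * pi * \<theta>)) = 1" by (simp only: Complex.DeMoivre)
  then obtain n :: int where "real i * (2 * pi * \<theta>) = of_int (2 * n) * pi"
    by (auto simp: cis_conv_exp exp_eq_1)
  then have "\<theta> = of_int n / of_nat i" using \<open>0 < i\<close> by (simp add: field_simps)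
  then show False using assms by auto
qed

lemma ln_norm_cocycle_iter_A_continuous:
  assumes "\<alpha> \<noteq> 0" "\<beta> \<noteq> 0" "\<And>i. 0 < i \<Longrightarrow> \<beta> ^ i \<noteq> 1"
    and "continuous_on X g"
  shows "continuous_on X (\<lambda>x. ln (norm (cocycle_iter (A_cocycle \<alpha>) \<beta> n (g x))))"
  by (intro continuous_on_ln continuous_on_norm
      continuous_on_compose2[OF continuous_on_cocycle_iter_A \<open>continuous_on X g\<close>])
     (use cocycle_iter_A_nonzero[OF assms(1-3)] in auto)

text \<open>Half the logarithm of \<open>|det|\<close> bounds the integrand from below, and Jensen's
  formula integrates each factor of the determinant. The exponent \<open>m\<close> lets the cases
  \<open>y\<close> and \<open>y^2\<close> share one proof.\<close>

lemma ln_norm_integral_lower_bound: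
  fixes n :: nat
  assumes "norm \<alpha> = 1" "norm \<beta> = 1" "\<And>i. 0 < i \<Longrightarrow> \<beta> ^ i \<noteq> 1" "0 < m" "0 < \<rho>"
  defines "I \<equiv> \<lambda>r. integral {0..2 * pi}
     (\<lambda>t. ln (norm (cocycle_iter (A_cocycle \<alpha>) \<beta> n ((complex_of_real r * cis t) ^ m))))"
  shows "real n * pi * max 0 (ln (\<rho> ^ m)) \<le> I \<rho>"
proof -
  have nz: "\<alpha> \<noteq> 0" "\<beta> \<noteq> 0" using assms(1,2) by auto
  have off1: "real n * pi * max 0 (ln (r ^ m)) \<le> I r" if r: "0 < r" "r \<noteq> 1" for r
  proof -
    define w where "w = (\<lambda>t. of_real (r ^ m) * cis t ^ m)"
    have w: "(complex_of_real r * cis t) ^ m = w t" for t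
      by (simp add: w_def power_mult_distrib)
    have rm: "r ^ m > 0" "r ^ m \<noteq> 1"
      using r \<open>0 < m\<close> power_eq_iff_eq_base[of m r 1] by auto
    have "((\<lambda>t. \<Sum>k<n. ln (norm (\<alpha> - \<beta> ^ k * w t))) has_integral
        (\<Sum>k<n. 2 * pi * max 0 (ln (r ^ m)))) {0..2 * pi}"
      unfolding w_def using assms rm
      by (intro has_integral_sum Jensen_circle) (auto simp: norm_power)
    from has_integral_mult_right[OF this, of "1 / 2"]
    have "((\<lambda>t. 1 / 2 * (\<Sum>k<n. ln (norm (\<alpha> - \<beta> ^ k * w t)))) has_integral
        real n * pi * max 0 (ln (r ^ m))) {0..2 * pi}"
      by (simp add: mult_ac)
    moreover have "((\<lambda>t. ln (norm (cocycle_iter (A_cocycle \<alpha>) \<beta> n (w t)))) has_integral I r) {0..2 * pi}"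
      unfolding I_def w
      by (intro integrable_integral integrable_continuous_real
          ln_norm_cocycle_iter_A_continuous nz assms) (auto simp: w_def intro!: continuous_intros)
    moreover have "1 / 2 * (\<Sum>k<n. ln (norm (\<alpha> - \<beta> ^ k * w t)))
        \<le> ln (norm (cocycle_iter (A_cocycle \<alpha>) \<beta> n (w t)))" for t
    proof -
      let ?P = "cocycle_iter (A_cocycle \<alpha>) \<beta> n (w t)"
      \<comment> \<open>Off the unit circle the two terms have different moduli, so the logarithm of
        the product really splits into a sum.\<close>
      have ne: "\<alpha> - \<beta> ^ k * w t \<noteq> 0" for k
      proof
        assume "\<alpha> - \<beta> ^ k * w t = 0"
        then have "norm \<alpha> = norm (\<beta> ^ k * w t)" by simp
        then show False
          using assms(1,2) rm r by (simp add: w_def norm_mult norm_power)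
      qed
      have "(\<Sum>k<n. ln (norm (\<alpha> - \<beta> ^ k * w t))) = ln (norm (det ?P))"
        using ne by (simp add: det_cocycle_iter_A prod_norm[symmetric] ln_prod)
      also have "\<dots> \<le> ln ((norm ?P)\<^sup>2)"
        using norm_det_mat2_le[of ?P] ne by (intro ln_mono) (auto simp: det_cocycle_iter_A)
      also have "\<dots> = 2 * ln (norm ?P)"
        using cocycle_iter_A_nonzero[OF nz assms(3)] by (simp add: ln_realpow)
      finally show ?thesis by simp
    qed
    ultimately show ?thesis by (rule has_integral_le)
  qed
  show ?thesis
  proof (cases "\<rho> = 1")
    case False
    then show ?thesis using off1 \<open>0 < \<rho>\<close> by blast
  next
    case True
    \<comment> \<open>At radius 1 the determinant can vanish on the circle, but the iterates do not,
      so the integral is continuous in the radius and the bound, here 0, passes to the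
      limit.\<close>
    have "continuous_on UNIV I"
      unfolding I_def cbox_interval[symmetric]
      by (intro integral_continuous_on_param)
         (unfold split_def, intro ln_norm_cocycle_iter_A_continuous nz assms(3) continuous_intros)
    then have "isCont I 1" by (simp add: continuous_on_eq_continuous_at)
    moreover have "(\<lambda>j. 1 + inverse (real (Suc j))) \<longlonglongrightarrow> 1"
      using tendsto_add[OF tendsto_const LIMSEQ_inverse_real_of_nat, of 1] by simp
    ultimately have "(\<lambda>j. I (1 + inverse (real (Suc j)))) \<longlonglongrightarrow> I 1"
      by (rule isCont_tendsto_compose)
    moreover have "0 \<le> I (1 + inverse (real (Suc j)))" for j
    proof -
      have "0 \<le> real n * pi * max 0 (ln ((1 + inverse (real (Suc j))) ^ m))" by simp
      also have "\<dots> \<le> I (1 + inverse (real (Suc j)))"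
        by (rule off1) (auto simp: add_pos_pos)
      finally show ?thesis .
    qed
    ultimately have "0 \<le> I 1" by (intro LIMSEQ_le_const) auto
    with True show ?thesis by simp
  qed
qed

section \<open>Convergence of the averages and the two cocycles\<close>

text \<open>The averages lie between \<open>L\<close> and \<open>c / n + L + \<delta>\<close> for
  every \<open>\<delta> > 0\<close>, with \<open>c\<close> depending on \<open>\<delta>\<close>. The
  hypothesis on the iterates is met with \<open>m = 1\<close> by \<open>A_cocycle\<close> and with
  \<open>m = 2\<close> by \<open>B_cocycle\<close>.\<close>

lemma lyap_seq_tendsto:
  assumes "norm \<alpha> = 1" "norm \<beta> = 1" "\<And>i. 0 < i \<Longrightarrow> \<beta> ^ i \<noteq> 1" "0 < m" "0 < \<rho>"
    and iter: "\<And>n y. cocycle_iter C \<gamma> n y = cocycle_iter (A_cocycle \<alpha>) \<beta> n (y ^ m)"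
  shows "lyap_seq C \<gamma> \<rho> \<longlonglongrightarrow> max 0 (ln (\<rho> ^ m)) / 2"
proof -
  define L where "L = max 0 (ln (\<rho> ^ m)) / 2"
  \<comment> \<open>Chosen so that its square is \<open>max 1 (\<rho> ^ m)\<close>.\<close>
  define S where "S = exp L"
  define F where "F = (\<lambda>n t. ln (norm (cocycle_iter (A_cocycle \<alpha>) \<beta> n ((complex_of_real \<rho> * cis t) ^ m))))"
  have nz: "\<alpha> \<noteq> 0" "\<beta> \<noteq> 0" using assms(1,2) by auto
  have contF: "continuous_on {0..2 * pi} (F n)" for n
    unfolding F_def
    by (intro ln_norm_cocycle_iter_A_continuous nz assms continuous_intros)
  have seq: "lyap_seq C \<gamma> \<rho> n = integral {0..2 * pi} (F n) / (2 * pi) / real n" for n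
    using set_borel_integral_eq_integral(2)[OF borel_integrable_atLeastAtMost'[OF contF[of n]]]
    unfolding lyap_seq_def circle_avg_log_def iter F_def by simp
  have S: "S \<ge> 1" "\<rho> ^ m \<le> S\<^sup>2"
  proof -
    show "S \<ge> 1" by (simp add: S_def L_def)
    have "\<rho> ^ m = exp (ln (\<rho> ^ m))" using \<open>0 < \<rho>\<close> by simp
    also have "\<dots> \<le> exp (2 * L)" by (simp add: L_def del: ln_realpow)
    also have "\<dots> = S\<^sup>2" by (simp add: S_def exp_double)
    finally show "\<rho> ^ m \<le> S\<^sup>2" .
  qed
  \<comment> \<open>At \<open>n = 0\<close> division by zero makes the term 0, so the bound is only
    claimed for positive \<open>n\<close>.\<close>
  have lower: "L \<le> lyap_seq C \<gamma> \<rho> n" if "0 < n" for n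
  proof -
    have "real n * pi * (2 * L) \<le> integral {0..2 * pi} (F n)"
      using ln_norm_integral_lower_bound[OF assms(1-5), of n] by (simp add: F_def L_def)
    then show ?thesis using that by (simp add: seq field_simps)
  qed
  have upper: "\<exists>c. \<forall>n>0. lyap_seq C \<gamma> \<rho> n \<le> c / real n + (L + \<delta>)" if \<delta>: "\<delta> > 0" for \<delta>
  proof -
    obtain K where "K > 0" and K: "\<And>y n. norm y \<le> S\<^sup>2 \<Longrightarrow>
        norm (cocycle_iter (A_cocycle \<alpha>) \<beta> n y) \<le> K * (S * exp \<delta>) ^ n"
      using cocycle_iter_A_bound[OF assms(1-3) \<delta> S(1)] by blast
    have "lyap_seq C \<gamma> \<rho> n \<le> ln K / real n + (L + \<delta>)" if "0 < n" for n
    proof -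
      have "F n t \<le> ln K + real n * (L + \<delta>)" for t
      proof -
        let ?P = "cocycle_iter (A_cocycle \<alpha>) \<beta> n ((complex_of_real \<rho> * cis t) ^ m)"
        have "norm ?P \<le> K * (S * exp \<delta>) ^ n"
          using S(2) \<open>0 < \<rho>\<close> by (intro K) (simp add: norm_power norm_mult)
        then have "ln (norm ?P) \<le> ln (K * (S * exp \<delta>) ^ n)"
          using cocycle_iter_A_nonzero[OF nz assms(3)] by (intro ln_mono) auto
        also have "\<dots> = ln K + real n * (L + \<delta>)"
          using \<open>K > 0\<close> by (simp add: S_def ln_mult ln_realpow exp_add[symmetric])
        finally show ?thesis by (simp add: F_def)
      qed
      then have "integral {0..2 * pi} (F n) \<le> integral {0..2 * pi} (\<lambda>t. ln K + real n * (L + \<delta>))"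
        by (intro integral_le integrable_continuous_real contF continuous_intros)
      also have "\<dots> = 2 * pi * (ln K + real n * (L + \<delta>))" by simp
      finally show ?thesis using that by (simp add: seq field_simps)
    qed
    then show ?thesis by blast
  qed
  have "lyap_seq C \<gamma> \<rho> \<longlonglongrightarrow> L"
  proof (rule LIMSEQ_I)
    fix e :: real assume "e > 0"
    then obtain c where c: "\<And>n. n > 0 \<Longrightarrow> lyap_seq C \<gamma> \<rho> n \<le> c / real n + (L + e / 2)"
      using upper[of "e / 2"] by auto
    have "(\<lambda>n. c / real n) \<longlonglongrightarrow> 0" by (rule lim_const_over_n)
    then obtain N where N: "\<And>n. n \<ge> N \<Longrightarrow> c / real n < e / 2"
      using order_tendstoD(2)[of "\<lambda>n. c / real n" 0 sequentially "e / 2"] \<open>e > 0\<close>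
      by (auto simp: eventually_sequentially)
    have "norm (lyap_seq C \<gamma> \<rho> n - L) < e" if "n \<ge> Suc N" for n
    proof -
      have "0 < n" "N \<le> n" using that by auto
      from c[OF this(1)] N[OF this(2)] lower[OF this(1)] show ?thesis
        unfolding real_norm_def by linarith
    qed
    then show "\<exists>no. \<forall>n\<ge>no. norm (lyap_seq C \<gamma> \<rho> n - L) < e" by blast
  qed
  then show ?thesis by (simp add: L_def)
qed

lemma cocycle_iter_B:
  "cocycle_iter (B_cocycle \<alpha>) s n y = cocycle_iter (A_cocycle \<alpha>) (s\<^sup>2) n (y\<^sup>2)"
proof (induction n)
  case (Suc n)
  have "(s ^ n * y)\<^sup>2 = (s\<^sup>2) ^ n * y\<^sup>2"
    by (simp add: power_mult_distrib mult.commute flip: power_mult)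
  with Suc show ?case by (simp add: A_cocycle_def B_cocycle_def)
qed simp

lemma sq_map_semiconj:
  assumes "s\<^sup>2 = \<beta>"
  shows "f_map \<alpha> \<beta> \<circ> sq_map = sq_map \<circ> g_map \<alpha> s"
  by (auto simp: f_map_def g_map_def sq_map_def power_mult_distrib assms)

theorem theoremA:
  fixes \<alpha> \<beta> :: complex and \<theta> :: real
  assumes "norm \<alpha> = 1"
    and "\<beta> = cis (2 * pi * \<theta>)"
    and "\<theta> \<notin> \<rat>"
  shows "(\<forall>\<rho>>1. convergent (lyap_seq (A_cocycle \<alpha>) \<beta> \<rho>)
                 \<and> lyapunov_exponent (A_cocycle \<alpha>) \<beta> \<rho> > 0)
       \<and> (\<forall>\<rho>. 0 < \<rho> \<and> \<rho> \<le> 1 \<longrightarrow> convergent (lyap_seq (A_cocycle \<alpha>) \<beta> \<rho>)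
                 \<and> lyapunov_exponent (A_cocycle \<alpha>) \<beta> \<rho> = 0)
       \<and> (\<forall>s. s^2 = \<beta> \<longrightarrow>
            f_map \<alpha> \<beta> \<circ> sq_map = sq_map \<circ> g_map \<alpha> s
          \<and> (\<forall>\<rho>>0. convergent (lyap_seq (B_cocycle \<alpha>) s \<rho>)
                 \<and> lyapunov_exponent (B_cocycle \<alpha>) s \<rho> = max 0 (ln \<rho>)))"
proof -
  have \<beta>: "norm \<beta> = 1" "\<And>i. 0 < i \<Longrightarrow> \<beta> ^ i \<noteq> 1"
    using aperiodic_rotation assms by auto
  have A: "lyap_seq (A_cocycle \<alpha>) \<beta> \<rho> \<longlonglongrightarrow> max 0 (ln \<rho>) / 2" if "0 < \<rho>" for \<rho>
    using lyap_seq_tendsto[OF assms(1) \<beta> zero_less_one that, of "A_cocycle \<alpha>" \<beta>] by simp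
  \<comment> \<open>Squaring replaces the radius by \<open>\<rho>^2\<close> and so cancels the
    factor \<open>1 / 2\<close> present in the limit for \<open>A_cocycle\<close>.\<close>
  have B: "lyap_seq (B_cocycle \<alpha>) s \<rho> \<longlonglongrightarrow> max 0 (ln \<rho>)" if "s\<^sup>2 = \<beta>" "0 < \<rho>" for s \<rho>
  proof -
    have "lyap_seq (B_cocycle \<alpha>) s \<rho> \<longlonglongrightarrow> max 0 (ln (\<rho>\<^sup>2)) / 2"
      by (rule lyap_seq_tendsto[OF assms(1) \<beta>]) (simp_all add: that cocycle_iter_B)
    moreover have "max 0 (ln (\<rho>\<^sup>2)) / 2 = max 0 (ln \<rho>)"
      using that by (simp add: ln_realpow max_def)
    ultimately show ?thesis by simp
  qed
  show ?thesis
    unfolding lyapunov_exponent_def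
  proof (intro conjI allI impI)
    fix \<rho> :: real assume "\<rho> > 1"
    then have "0 < \<rho>" "0 < ln \<rho>" by auto
    then show "lim (lyap_seq (A_cocycle \<alpha>) \<beta> \<rho>) > 0"
      using limI[OF A[of \<rho>]] by (simp only: max_absorb2 less_imp_le half_gt_zero)
  next
    fix \<rho> :: real assume "0 < \<rho> \<and> \<rho> \<le> 1"
    then have "0 < \<rho>" "max 0 (ln \<rho>) = 0" by auto
    then show "lim (lyap_seq (A_cocycle \<alpha>) \<beta> \<rho>) = 0"
      using limI[OF A[of \<rho>]] by simp
  qed (auto intro: convergentI A B limI sq_map_semiconj order.strict_trans[OF zero_less_one])
qed

end
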